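(* For any $n\ge 5$, the $\mathbb{Z}_2$-lattice $\mathbb{H}^{n-1}\perp\langle 1,-1\rangle$ is primitively $n$-universal. In particular, $u^\ast_{\mathbb{Z}_2}(n) = 2n$ for any $n\ge 5$.
   Context: A $\mathbb{Z}_2$-lattice is a finitely generated $\mathbb{Z}_2$-submodule of a quadratic space $(V,B)$ over $\mathbb{Q}_2$, assumed integral ($B(L,L)\subseteq\mathbb{Z}_2$) and nondegenerate. A representation is a $\mathbb{Z}_2$-linear map preserving $B$; it is primitive if its image is a direct summand. A lattice is primitively $n$-universal if it primitively represents every $\mathbb{Z}_2$-lattice of rank $n$; $u^\ast_{\mathbb{Z}_2}(n)$ is the minimal rank of such a lattice. $\mathbb{H}$ is the binary lattice with Gram matrix $\begin{pmatrix}0&1\\1&0\end{pmatrix}$, $\mathbb{H}^{k}$ the orthogonal sum of $k$ copies, $\langle 1,-1\rangle$ the lattice with Gram matrix $\operatorname{diag}(1,-1)$. *)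

theory Defs
  imports "HOL-Combinatorics.Permutations" "HOL-Number_Theory.Cong"
begin

text \<open>2-adic integers as the inverse limit of the rings Z/2^k Z.
  An element of Z_2 is represented by a compatible sequence x with
  x (Suc k) = x k (mod 2^k); the value x k is the reduction mod 2^k.
  Two representatives denote the same 2-adic integer iff they agree mod 2^k
  at every level k.  Ring operations are computed levelwise.\<close>

type_synonym z2 = "nat \<Rightarrow> int"

definition z2_valid :: "z2 \<Rightarrow> bool" where
  "z2_valid x \<longleftrightarrow> (\<forall>k. [x (Suc k) = x k] (mod 2 ^ k))"

definition z2_eq :: "z2 \<Rightarrow> z2 \<Rightarrow> bool" where
  "z2_eq x y \<longleftrightarrow> (\<forall>k. [x k = y k] (mod 2 ^ k))"

definition z2_const :: "int \<Rightarrow> z2" where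
  "z2_const c = (\<lambda>k. c)"

text \<open>Matrices over Z_2 (sizes given explicitly; entries outside the range are irrelevant).\<close>

type_synonym z2mat = "nat \<Rightarrow> nat \<Rightarrow> z2"

definition valid_mat :: "nat \<Rightarrow> nat \<Rightarrow> z2mat \<Rightarrow> bool" where
  "valid_mat m n A \<longleftrightarrow> (\<forall>i<m. \<forall>j<n. z2_valid (A i j))"

definition idet :: "nat \<Rightarrow> (nat \<Rightarrow> nat \<Rightarrow> int) \<Rightarrow> int" where
  "idet n M = (\<Sum>p | p permutes {..<n}. sign p * (\<Prod>i<n. M i (p i)))"

text \<open>A Z_2-lattice of rank m, given by its Gram matrix G with respect to a basis:
  symmetric, with entries in Z_2 (integral), and nondegenerate (det G \<noteq> 0 in Z_2).\<close>
definition z2_lattice :: "nat \<Rightarrow> z2mat \<Rightarrow> bool" where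
  "z2_lattice m G \<longleftrightarrow> valid_mat m m G
     \<and> (\<forall>i<m. \<forall>j<m. z2_eq (G i j) (G j i))
     \<and> (\<exists>k. \<not> [idet m (\<lambda>i j. G i j k) = 0] (mod 2 ^ k))"

text \<open>X (an m x n matrix over Z_2, columns = images of the basis of the rank-n lattice
  with Gram matrix A) is a representation into the lattice with Gram matrix G:
  X^T G X = A over Z_2.\<close>
definition z2_represents :: "nat \<Rightarrow> z2mat \<Rightarrow> nat \<Rightarrow> z2mat \<Rightarrow> z2mat \<Rightarrow> bool" where
  "z2_represents m G n A X \<longleftrightarrow> valid_mat m n X \<and>
     (\<forall>k. \<forall>i<n. \<forall>j<n.
        [(\<Sum>a<m. \<Sum>b<m. X a i k * G a b k * X b j k) = A i j k] (mod 2 ^ k))"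

text \<open>The image of X is a direct summand of Z_2^m: the columns of X can be completed
  by m-n further columns Y to a matrix [X|Y] invertible over Z_2.\<close>
definition z2_primitive :: "nat \<Rightarrow> nat \<Rightarrow> z2mat \<Rightarrow> bool" where
  "z2_primitive m n X \<longleftrightarrow> n \<le> m \<and>
     (\<exists>Y W. valid_mat m (m - n) Y \<and> valid_mat m m W \<and>
        (let C = (\<lambda>i j. if j < n then X i j else Y i (j - n)) in
          (\<forall>k. \<forall>i<m. \<forall>j<m.
             [(\<Sum>l<m. C i l k * W l j k) = (if i = j then 1 else 0)] (mod 2 ^ k)) \<and>
          (\<forall>k. \<forall>i<m. \<forall>j<m.
             [(\<Sum>l<m. W i l k * C l j k) = (if i = j then 1 else 0)] (mod 2 ^ k))))"

definition prim_n_universal :: "nat \<Rightarrow> nat \<Rightarrow> z2mat \<Rightarrow> bool" where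
  "prim_n_universal n m G \<longleftrightarrow>
     (\<forall>A. z2_lattice n A \<longrightarrow> (\<exists>X. z2_represents m G n A X \<and> z2_primitive m n X))"

definition u_star :: "nat \<Rightarrow> nat" where
  "u_star n = (LEAST m. \<exists>G. z2_lattice m G \<and> prim_n_universal n m G)"

definition H_perp_gram :: "nat \<Rightarrow> z2mat" where
  "H_perp_gram n = (\<lambda>i j. z2_const
     (if i < 2 * (n - 1) \<and> j < 2 * (n - 1) then
        (if i div 2 = j div 2 \<and> i \<noteq> j then 1 else 0)
      else if i = 2 * (n - 1) \<and> j = 2 * (n - 1) then 1
      else if i = 2 * (n - 1) + 1 \<and> j = 2 * (n - 1) + 1 then -1
      else 0))"

end

theory Submission
  imports Defs "Jordan_Normal_Form.Determinant"
begin

text \<open>Let \<open>N\<close> have rank \<open>n\<close>. If \<open>N\<close> has a basis whose vectors have even norm except for one vector,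
  whose norm \<open>a\<close> is primitively represented by \<open>\<langle>1,-1\<rangle>\<close>, then \<open>N\<close> embeds primitively: send that vector
  into \<open>\<langle>1,-1\<rangle>\<close> and the others to \<open>e\<^sub>b\<close>, and repair the remaining products by the \<open>f\<^sub>b\<close>; only the
  norms of the other vectors have to be halved. The norms \<open>a\<close> that qualify include all odd \<open>a\<close> and
  all \<open>a\<close> divisible by \<open>8\<close>. If \<open>N\<close> is odd, a vector of odd norm can be added to the other basis
  vectors of odd norm. If \<open>N\<close> is even and \<open>n \<ge> 5\<close>, some primitive vector has norm divisible by \<open>8\<close>:
  a ternary integral quadratic form has a primitive even value, and applying this several times
  lifts it from a zero of half the norm mod \<open>2\<close> to one mod \<open>4\<close>.

  Conversely, a lattice that primitively represents the lattice \<open>2\<^sup>k I\<^sub>n\<close> has, in a suitable basis, a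
  Gram matrix with an \<open>n \<times> n\<close> block vanishing mod \<open>2\<^sup>k\<close>. In rank below \<open>2n\<close> this forces
  \<open>2\<^sup>k\<close> to divide the determinant, which fails for large \<open>k\<close>.\<close>

section \<open>Integer matrices as functions, and their congruences\<close>

lemma sum_lessThan_split:
  fixes f :: "nat \<Rightarrow> 'a::comm_monoid_add"
  shows "n \<le> m \<Longrightarrow> (\<Sum>k<m. f k) = (\<Sum>k<n. f k) + (\<Sum>k=n..<m. f k)"
  unfolding lessThan_atLeast0 by (simp add: sum.atLeastLessThan_concat)

text \<open>Only the inner dimension is a parameter. Associativity and transposition then hold as
  equations of functions; bounds on the indices enter only with the identity matrix and with
  congruences.\<close>

definition mprod :: "nat \<Rightarrow> (nat \<Rightarrow> nat \<Rightarrow> int) \<Rightarrow> (nat \<Rightarrow> nat \<Rightarrow> int) \<Rightarrow> nat \<Rightarrow> nat \<Rightarrow> int" where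
  "mprod l A B = (\<lambda>i j. \<Sum>k<l. A i k * B k j)"

definition mid :: "nat \<Rightarrow> nat \<Rightarrow> int" where
  "mid = (\<lambda>i j. if i = j then 1 else 0)"

definition mtr :: "(nat \<Rightarrow> nat \<Rightarrow> int) \<Rightarrow> nat \<Rightarrow> nat \<Rightarrow> int" where
  "mtr A = (\<lambda>i j. A j i)"

definition mcong :: "int \<Rightarrow> nat \<Rightarrow> nat \<Rightarrow> (nat \<Rightarrow> nat \<Rightarrow> int) \<Rightarrow> (nat \<Rightarrow> nat \<Rightarrow> int) \<Rightarrow> bool" where
  "mcong q r c A B \<longleftrightarrow> (\<forall>i<r. \<forall>j<c. [A i j = B i j] (mod q))"

lemma mprod_assoc: "mprod q (mprod p A B) C = mprod p A (mprod q B C)"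
proof (intro ext)
  fix i j
  have "mprod q (mprod p A B) C i j = (\<Sum>k<q. \<Sum>l<p. A i l * B l k * C k j)"
    by (simp add: mprod_def sum_distrib_right)
  also have "\<dots> = (\<Sum>l<p. \<Sum>k<q. A i l * B l k * C k j)"
    by (rule sum.swap)
  also have "\<dots> = mprod p A (mprod q B C) i j"
    by (simp add: mprod_def sum_distrib_left mult.assoc)
  finally show "mprod q (mprod p A B) C i j = mprod p A (mprod q B C) i j" .
qed

lemma mtr_mprod: "mtr (mprod l A B) = mprod l (mtr B) (mtr A)"
  by (intro ext) (simp add: mtr_def mprod_def mult.commute)

lemma mtr_mid [simp]: "mtr mid = mid"
  by (intro ext) (simp add: mtr_def mid_def)

lemma mprod_mid_left: "i < l \<Longrightarrow> mprod l mid B i j = B i j"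
  by (simp add: mprod_def mid_def if_distrib[of "\<lambda>x. x * _"] cong: if_cong)

lemma mprod_mid_right: "j < l \<Longrightarrow> mprod l A mid i j = A i j"
  by (simp add: mprod_def mid_def if_distrib[of "\<lambda>x. _ * x"] cong: if_cong)

lemma mcong_refl [simp]: "mcong q r c A A"
  by (simp add: mcong_def)

lemma mcong_trans [trans]: "mcong q r c A B \<Longrightarrow> mcong q r c B C \<Longrightarrow> mcong q r c A C"
  unfolding mcong_def by (meson cong_trans)

lemma mcong_mtr: "mcong q r c A B \<Longrightarrow> mcong q c r (mtr A) (mtr B)"
  by (simp add: mcong_def mtr_def)

lemma mcong_mprod:
  assumes "mcong q r l A A'" and "mcong q l c B B'"
  shows "mcong q r c (mprod l A B) (mprod l A' B')"
  using assms unfolding mcong_def mprod_def by (auto intro!: cong_sum cong_mult)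

lemma mcong_mid_left: "mcong q l c A B \<Longrightarrow> mcong q l c (mprod l mid A) B"
  by (simp add: mcong_def mprod_mid_left)

lemma mcong_mid_right: "mcong q r l A B \<Longrightarrow> mcong q r l (mprod l A mid) B"
  by (simp add: mcong_def mprod_mid_right)

section \<open>Representations and 2-adic integers, level by level\<close>

lemma z2_represents_iff:
  "z2_represents m G n A X \<longleftrightarrow> valid_mat m n X \<and>
     (\<forall>k. mcong (2 ^ k) n n
        (mprod m (mtr (\<lambda>i j. X i j k)) (mprod m (\<lambda>i j. G i j k) (\<lambda>i j. X i j k)))
        (\<lambda>i j. A i j k))"
  unfolding z2_represents_def mcong_def mprod_def mtr_def
  by (simp add: sum_distrib_left mult.assoc)

lemma z2_primitive_iff:
  "z2_primitive m n X \<longleftrightarrow> n \<le> m \<and> (\<exists>Y W. valid_mat m (m - n) Y \<and> valid_mat m m W \<and>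
     (\<forall>k. mcong (2 ^ k) m m
        (mprod m (\<lambda>i j. if j < n then X i j k else Y i (j - n) k) (\<lambda>i j. W i j k)) mid) \<and>
     (\<forall>k. mcong (2 ^ k) m m
        (mprod m (\<lambda>i j. W i j k) (\<lambda>i j. if j < n then X i j k else Y i (j - n) k)) mid))"
proof -
  have "(if j < n then X i j else Y i (j - n)) k = (if j < n then X i j k else Y i (j - n) k)"
    for i j k and Y :: z2mat
    by simp
  then show ?thesis
    unfolding z2_primitive_def mcong_def mprod_def mid_def Let_def by simp
qed

lemma z2_valid_const: "z2_valid (\<lambda>k. c)"
  by (simp add: z2_valid_def)

lemma z2_valid_add: "z2_valid x \<Longrightarrow> z2_valid y \<Longrightarrow> z2_valid (\<lambda>k. x k + y k)"
  by (simp add: z2_valid_def cong_add)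

lemma z2_valid_diff: "z2_valid x \<Longrightarrow> z2_valid y \<Longrightarrow> z2_valid (\<lambda>k. x k - y k)"
  by (simp add: z2_valid_def cong_diff)

lemma z2_valid_mult: "z2_valid x \<Longrightarrow> z2_valid y \<Longrightarrow> z2_valid (\<lambda>k. x k * y k)"
  by (simp add: z2_valid_def cong_mult)

lemma z2_valid_sum: "(\<And>i. i \<in> I \<Longrightarrow> z2_valid (x i)) \<Longrightarrow> z2_valid (\<lambda>k. \<Sum>i\<in>I. x i k)"
  unfolding z2_valid_def by (auto intro!: cong_sum)

lemma z2_valid_if: "(P \<Longrightarrow> z2_valid x) \<Longrightarrow> (\<not> P \<Longrightarrow> z2_valid y) \<Longrightarrow> z2_valid (\<lambda>k. if P then x k else y k)"
  by (cases P) simp_all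

lemmas z2_valid_intros =
  z2_valid_const z2_valid_add z2_valid_diff z2_valid_mult z2_valid_sum z2_valid_if

lemma z2_valid_le:
  assumes "z2_valid x" and "k \<le> l"
  shows "[x l = x k] (mod 2 ^ k)"
  using assms(2)
proof (induction l rule: dec_induct)
  case (step l)
  have "[x (Suc l) = x l] (mod 2 ^ l)"
    using assms(1) by (simp add: z2_valid_def)
  then have "[x (Suc l) = x l] (mod 2 ^ k)"
    by (rule cong_dvd_modulus) (simp add: le_imp_power_dvd step.hyps)
  with step.IH show ?case
    by (rule cong_trans[rotated])
qed simp

section \<open>Change of basis\<close>

text \<open>Every base change used below has integer entries, so its inverse is exact over the
  integers and serves all levels at once.\<close>

definition inverse_pair :: "nat \<Rightarrow> (nat \<Rightarrow> nat \<Rightarrow> int) \<Rightarrow> (nat \<Rightarrow> nat \<Rightarrow> int) \<Rightarrow> bool" where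
  "inverse_pair n T S \<longleftrightarrow>
     (\<forall>i<n. \<forall>j<n. mprod n T S i j = mid i j \<and> mprod n S T i j = mid i j)"

definition gram_change :: "nat \<Rightarrow> (nat \<Rightarrow> nat \<Rightarrow> int) \<Rightarrow> z2mat \<Rightarrow> z2mat" where
  "gram_change n T A = (\<lambda>i j k. mprod n (mtr T) (mprod n (\<lambda>a b. A a b k) T) i j)"

definition prim_rep :: "nat \<Rightarrow> z2mat \<Rightarrow> nat \<Rightarrow> z2mat \<Rightarrow> bool" where
  "prim_rep m G n A \<longleftrightarrow> (\<exists>X. z2_represents m G n A X \<and> z2_primitive m n X)"

text \<open>If \<open>X'\<close> represents \<open>gram_change n T A\<close>, then
  \<open>X' S\<close> represents \<open>A\<close>. The completing columns are kept: the full matrix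
  is multiplied on the right by the block matrix of \<open>S\<close> and an identity, its inverse on
  the left by that of \<open>T\<close> and an identity.\<close>

lemma prim_rep_gram_change:
  assumes inv: "inverse_pair n T S" and rep: "prim_rep m G n (gram_change n T A)"
  shows "prim_rep m G n A"
proof -
  obtain X' Y W' where nm: "n \<le> m" and vX': "valid_mat m n X'" and vY: "valid_mat m (m - n) Y"
    and vW': "valid_mat m m W'"
    and X': "\<And>k. mcong (2 ^ k) n n
        (mprod m (mtr (\<lambda>i j. X' i j k)) (mprod m (\<lambda>i j. G i j k) (\<lambda>i j. X' i j k)))
        (\<lambda>i j. gram_change n T A i j k)"
    and CW': "\<And>k. mcong (2 ^ k) m m
        (mprod m (\<lambda>i j. if j < n then X' i j k else Y i (j - n) k) (\<lambda>i j. W' i j k)) mid"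
    and WC': "\<And>k. mcong (2 ^ k) m m
        (mprod m (\<lambda>i j. W' i j k) (\<lambda>i j. if j < n then X' i j k else Y i (j - n) k)) mid"
    using rep unfolding prim_rep_def z2_represents_iff z2_primitive_iff by blast
  have TS: "mcong q n n (mprod n T S) mid" and ST: "mcong q n n (mprod n S T) mid" for q
    using inv by (simp_all add: inverse_pair_def mcong_def)
  define X where "X i j k = mprod n (\<lambda>i j. X' i j k) S i j" for i j k
  \<comment> \<open>\<open>D T\<close> is block diagonal, with blocks \<open>T\<close> and the
    identity of size \<open>m - n\<close>.\<close>
  define D where "D T i j = (if i < n \<and> j < n then T i j else mid i j)" for T i j
  define W where "W i j k = mprod m (D T) (\<lambda>i j. W' i j k) i j" for i j k
  have D: "mprod m (D T) (D S) i j = mid i j"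
    if "i < m" "j < m" and "\<And>i j. i < n \<Longrightarrow> j < n \<Longrightarrow> mprod n T S i j = mid i j" for T S i j
  proof -
    have "mprod m (D T) (D S) i j = (\<Sum>k<n. D T i k * D S k j) + (\<Sum>k=n..<m. D T i k * D S k j)"
      unfolding mprod_def by (rule sum_lessThan_split[OF nm])
    also have "(\<Sum>k=n..<m. D T i k * D S k j) = (\<Sum>k=n..<m. if i = k then mid i j else 0)"
      by (intro sum.cong) (auto simp: D_def mid_def)
    also have "\<dots> = (if n \<le> i then mid i j else 0)"
      using that by simp
    also have "(\<Sum>k<n. D T i k * D S k j) = (if i < n \<and> j < n then mprod n T S i j else 0)"
      unfolding mprod_def by (auto simp: D_def mid_def intro!: sum.neutral)
    finally show ?thesis
      using that by (auto simp: mid_def)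
  qed
  have DTS: "mcong q m m (mprod m (D T) (D S)) mid" and DST: "mcong q m m (mprod m (D S) (D T)) mid"
    for q
    using inv D unfolding inverse_pair_def mcong_def by auto
  let ?C' = "\<lambda>k i j. if j < n then X' i j k else Y i (j - n) k"
  let ?C = "\<lambda>k i j. if j < n then X i j k else Y i (j - n) k"
  have C: "mcong q m m (?C k) (mprod m (?C' k) (D S))" for q k
  proof -
    have "mprod m (?C' k) (D S) i j = ?C k i j" if "j < m" for i j
    proof -
      have "mprod m (?C' k) (D S) i j = (\<Sum>l<n. ?C' k i l * D S l j) + (\<Sum>l=n..<m. ?C' k i l * D S l j)"
        unfolding mprod_def by (rule sum_lessThan_split[OF nm])
      also have "(\<Sum>l=n..<m. ?C' k i l * D S l j) = (\<Sum>l=n..<m. if j = l then Y i (j - n) k else 0)"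
        by (intro sum.cong) (auto simp: D_def mid_def)
      also have "\<dots> = (if n \<le> j then Y i (j - n) k else 0)"
        using that by simp
      also have "(\<Sum>l<n. ?C' k i l * D S l j) = (if j < n then X i j k else 0)"
        unfolding mprod_def X_def by (auto simp: D_def mid_def intro!: sum.neutral)
      finally show ?thesis by auto
    qed
    then show ?thesis by (simp add: mcong_def)
  qed
  have "mcong (2 ^ k) m m (mprod m (?C k) (\<lambda>i j. W i j k)) mid" for k
  proof -
    have "mcong (2 ^ k) m m (mprod m (?C k) (\<lambda>i j. W i j k))
        (mprod m (mprod m (?C' k) (D S)) (mprod m (D T) (\<lambda>i j. W' i j k)))"
      unfolding W_def by (intro mcong_mprod C) simp_all
    also have "mprod m (mprod m (?C' k) (D S)) (mprod m (D T) (\<lambda>i j. W' i j k)) =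
        mprod m (?C' k) (mprod m (mprod m (D S) (D T)) (\<lambda>i j. W' i j k))"
      by (simp only: mprod_assoc)
    also have "mcong (2 ^ k) m m \<dots> (mprod m (?C' k) (mprod m mid (\<lambda>i j. W' i j k)))"
      by (intro mcong_mprod DST) simp_all
    also have "mcong (2 ^ k) m m \<dots> (mprod m (?C' k) (\<lambda>i j. W' i j k))"
      by (intro mcong_mprod mcong_mid_left) simp_all
    also note CW'
    finally show ?thesis .
  qed
  moreover have "mcong (2 ^ k) m m (mprod m (\<lambda>i j. W i j k) (?C k)) mid" for k
  proof -
    have "mcong (2 ^ k) m m (mprod m (\<lambda>i j. W i j k) (?C k))
        (mprod m (mprod m (D T) (\<lambda>i j. W' i j k)) (mprod m (?C' k) (D S)))"
      unfolding W_def by (intro mcong_mprod C) simp_all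
    also have "mprod m (mprod m (D T) (\<lambda>i j. W' i j k)) (mprod m (?C' k) (D S)) =
        mprod m (D T) (mprod m (mprod m (\<lambda>i j. W' i j k) (?C' k)) (D S))"
      by (simp only: mprod_assoc)
    also have "mcong (2 ^ k) m m \<dots> (mprod m (D T) (mprod m mid (D S)))"
      by (intro mcong_mprod WC') simp_all
    also have "mcong (2 ^ k) m m \<dots> (mprod m (D T) (D S))"
      by (intro mcong_mprod mcong_mid_left) simp_all
    also note DTS
    finally show ?thesis .
  qed
  moreover have "valid_mat m m W"
    using vW' unfolding valid_mat_def W_def mprod_def by (auto intro!: z2_valid_intros)
  ultimately have "z2_primitive m n X"
    using nm vY unfolding z2_primitive_iff by blast
  moreover have "z2_represents m G n A X"
    unfolding z2_represents_iff
  proof (intro conjI allI)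
    show "valid_mat m n X"
      using vX' unfolding valid_mat_def X_def mprod_def by (auto intro!: z2_valid_intros)
  next
    fix k
    let ?X = "\<lambda>i j. X' i j k" and ?G = "\<lambda>i j. G i j k" and ?A = "\<lambda>i j. A i j k"
    have XGX: "mprod m (mtr (\<lambda>i j. X i j k)) (mprod m ?G (\<lambda>i j. X i j k)) =
        mprod n (mtr S) (mprod n (mprod m (mtr ?X) (mprod m ?G ?X)) S)"
      unfolding X_def by (simp only: mtr_mprod mprod_assoc)
    have change: "mprod n (mtr S) (mprod n (mprod n (mtr T) (mprod n ?A T)) S) =
        mprod n (mtr (mprod n T S)) (mprod n ?A (mprod n T S))"
      by (simp only: mtr_mprod mprod_assoc)
    have "mcong (2 ^ k) n n (mprod n (mtr S) (mprod n (mprod m (mtr ?X) (mprod m ?G ?X)) S))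
        (mprod n (mtr S) (mprod n (mprod n (mtr T) (mprod n ?A T)) S))"
      by (rule mcong_mprod[OF mcong_refl mcong_mprod[OF X'[unfolded gram_change_def] mcong_refl]])
    moreover have "mcong (2 ^ k) n n (mprod n (mtr (mprod n T S)) (mprod n ?A (mprod n T S)))
        (mprod n (mtr mid) (mprod n ?A mid))"
      by (rule mcong_mprod[OF mcong_mtr[OF TS] mcong_mprod[OF mcong_refl TS]])
    moreover have "mcong (2 ^ k) n n (mprod n (mtr mid) (mprod n ?A mid)) ?A"
      by (simp add: mcong_mid_left mcong_mid_right)
    ultimately show "mcong (2 ^ k) n n (mprod m (mtr (\<lambda>i j. X i j k)) (mprod m ?G (\<lambda>i j. X i j k))) ?A"
      unfolding XGX change by (rule_tac mcong_trans[OF _ mcong_trans])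
  qed
  ultimately show ?thesis
    unfolding prim_rep_def by blast
qed

section \<open>Determinants and the lower bound for the rank\<close>

lemma idet_eq_det: "idet n M = det (mat n n (\<lambda>(i, j). M i j))"
  proof -
  have "(\<Prod>i<n. M i (p i)) = (\<Prod>i = 0..<n. mat n n (\<lambda>(i, j). M i j) $$ (i, p i))"
    if "p permutes {0..<n}" for p
    unfolding lessThan_atLeast0 using permutes_in_image[OF that] by (intro prod.cong) auto
  then show ?thesis
    unfolding idet_def det_def by (auto simp: lessThan_atLeast0 intro!: sum.cong)
qed

lemma idet_mprod: "idet n (mprod n A B) = idet n A * idet n B"
proof -
  have "mat n n (\<lambda>(i, j). mprod n A B i j) =
      mat n n (\<lambda>(i, j). A i j) * mat n n (\<lambda>(i, j). B i j)"
    by (intro eq_matI) (auto simp: mprod_def scalar_prod_def lessThan_atLeast0)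
  then show ?thesis
    by (simp add: idet_eq_det det_mult[of _ n])
qed

lemma idet_mtr: "idet n (mtr A) = idet n A"
proof -
  have "mat n n (\<lambda>(i, j). mtr A i j) = transpose_mat (mat n n (\<lambda>(i, j). A i j))"
    by (intro eq_matI) (auto simp: mtr_def)
  then show ?thesis
    by (simp add: idet_eq_det det_transpose[of _ n])
qed

lemma idet_scalar: "idet n (\<lambda>i j. if i = j then c else 0) = c ^ n"
proof -
  have "mat n n (\<lambda>(i, j). if i = j then c else 0) = c \<cdot>\<^sub>m 1\<^sub>m n"
    by (intro eq_matI) auto
  then show ?thesis
    by (simp add: idet_eq_det)
qed

lemma idet_mid: "idet n mid = 1"
  unfolding mid_def by (simp add: idet_scalar)

lemma idet_mcong:
  assumes "mcong q n n A B"
  shows "[idet n A = idet n B] (mod q)"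
  unfolding idet_def
proof (intro cong_sum cong_mult cong_prod)
  fix p i assume "p \<in> {p. p permutes {..<n}}" and "i \<in> {..<n}"
  then show "[A i (p i) = B i (p i)] (mod q)"
    using assms permutes_in_image[of p "{..<n}" i] by (simp add: mcong_def)
qed simp

text \<open>Pigeonhole: a permutation cannot send all \<open>n\<close> indices below
  \<open>n\<close> to the \<open>m - n < n\<close> others, so every term of the determinant has a
  factor from the block divisible by \<open>q\<close>.\<close>

lemma idet_zero_block:
  assumes "n \<le> m" and "m < 2 * n" and zero: "\<And>i j. i < n \<Longrightarrow> j < n \<Longrightarrow> q dvd F i j"
  shows "q dvd idet m F"
  unfolding idet_def
proof (intro dvd_sum)
  fix p assume "p \<in> {p. p permutes {..<m}}"
  then have p: "p permutes {..<m}" by simp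
  have "\<exists>i<n. p i < n"
  proof (rule ccontr)
    assume "\<not> (\<exists>i<n. p i < n)"
    with assms(1) p have "p ` {..<n} \<subseteq> {n..<m}"
      using permutes_in_image[OF p] by force
    then have "card (p ` {..<n}) \<le> m - n"
      using card_mono[of "{n..<m}"] by simp
    then show False
      using assms(1,2) by (simp add: card_image permutes_inj_on[OF p])
  qed
  then obtain i where "i < n" "p i < n" by blast
  then have "q dvd F i (p i)" by (rule zero)
  moreover have "F i (p i) dvd (\<Prod>i<m. F i (p i))"
    using \<open>i < n\<close> \<open>n \<le> m\<close> by (intro dvd_prodI) auto
  ultimately show "q dvd sign p * (\<Prod>i<m. F i (p i))"
    by (meson dvd_mult dvd_trans)
qed

text \<open>The determinant is \<open>2 ^ (k * n)\<close>, which is nonzero modulo the next power of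
  \<open>2\<close>; hence the level \<open>Suc (k * n)\<close>.\<close>

lemma z2_lattice_scalar:
  "z2_lattice n (\<lambda>i j. z2_const (if i = j then 2 ^ k else 0))"
proof -
  have "\<not> [idet n (\<lambda>i j. z2_const (if i = j then 2 ^ k else 0) (Suc (k * n))) = 0] (mod 2 ^ Suc (k * n))"
  proof
    assume "[idet n (\<lambda>i j. z2_const (if i = j then 2 ^ k else 0) (Suc (k * n))) = 0] (mod 2 ^ Suc (k * n))"
    then have "(2::int) ^ Suc (k * n) dvd 2 ^ (k * n)"
      by (simp add: z2_const_def idet_scalar cong_0_iff power_mult)
    then show False
      using zdvd_imp_le[of "2 ^ Suc (k * n)" "2 ^ (k * n)"] by simp
  qed
  then show ?thesis
    unfolding z2_lattice_def valid_mat_def z2_eq_def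
    by (intro conjI exI[of _ "Suc (k * n)"]) (auto simp: z2_const_def z2_valid_const)
qed

lemma prim_n_universal_rank_ge:
  assumes G: "z2_lattice m G" and univ: "prim_n_universal n m G"
  shows "2 * n \<le> m"
proof (rule ccontr)
  assume "\<not> 2 * n \<le> m"
  then have m: "m < 2 * n" by simp
  \<comment> \<open>A level at which the determinant of \<open>G\<close> is nonzero also serves as
    the exponent of the scalar lattice, so that everything happens modulo this one power of
    \<open>2\<close>.\<close>
  obtain k where k: "\<not> [idet m (\<lambda>i j. G i j k) = 0] (mod 2 ^ k)"
    using G unfolding z2_lattice_def by blast
  let ?q = "2 ^ k :: int"
  obtain X where "z2_represents m G n (\<lambda>i j. z2_const (if i = j then ?q else 0)) X"
    and "z2_primitive m n X"
    using univ z2_lattice_scalar unfolding prim_n_universal_def by blast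
  then obtain Y W where nm: "n \<le> m"
    and X: "mcong ?q n n
        (mprod m (mtr (\<lambda>i j. X i j k)) (mprod m (\<lambda>i j. G i j k) (\<lambda>i j. X i j k)))
        (\<lambda>i j. z2_const (if i = j then ?q else 0) k)"
    and CW: "mcong ?q m m
        (mprod m (\<lambda>i j. if j < n then X i j k else Y i (j - n) k) (\<lambda>i j. W i j k)) mid"
    unfolding z2_represents_iff z2_primitive_iff by blast
  define C where "C i j = (if j < n then X i j k else Y i (j - n) k)" for i j
  let ?G = "\<lambda>i j. G i j k" and ?W = "\<lambda>i j. W i j k"
  let ?F = "mprod m (mtr C) (mprod m ?G C)"
  have "?q dvd ?F i j" if "i < n" "j < n" for i j
  proof -
    have "?F i j = mprod m (mtr (\<lambda>i j. X i j k)) (mprod m ?G (\<lambda>i j. X i j k)) i j"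
      using that by (simp add: mprod_def mtr_def C_def)
    also have "[\<dots> = z2_const (if i = j then ?q else 0) k] (mod ?q)"
      using X that unfolding mcong_def by blast
    also have "[z2_const (if i = j then ?q else 0) k = 0] (mod ?q)"
      by (simp add: z2_const_def cong_0_iff)
    finally show ?thesis by (simp add: cong_0_iff)
  qed
  then have "?q dvd idet m ?F"
    using nm m by (rule_tac idet_zero_block)
  then have F0: "?q dvd idet m C * idet m ?G * idet m C"
    by (simp add: idet_mprod idet_mtr mult.assoc)
  \<comment> \<open>The completed matrix \<open>C\<close> is invertible modulo \<open>?q\<close>, so
    its determinant can be cancelled from \<open>F0\<close>.\<close>
  have "[idet m C * idet m ?W = 1] (mod ?q)"
    using idet_mcong[OF CW] by (simp add: idet_mprod idet_mid C_def[abs_def])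
  then have "[idet m ?G * ((idet m C * idet m ?W) * (idet m C * idet m ?W)) = idet m ?G * (1 * 1)] (mod ?q)"
    by (intro cong_mult) auto
  moreover have "idet m ?G * ((idet m C * idet m ?W) * (idet m C * idet m ?W)) =
      (idet m C * idet m ?G * idet m C) * (idet m ?W * idet m ?W)"
    by (simp add: algebra_simps)
  moreover have "?q dvd (idet m C * idet m ?G * idet m C) * (idet m ?W * idet m ?W)"
    using F0 by (rule dvd_mult2)
  ultimately have "?q dvd idet m ?G"
    by (simp add: cong_dvd_iff)
  with k show False by (simp add: cong_0_iff)
qed

section \<open>The explicit embedding and its inverse matrix\<close>

text \<open>The rows of \<open>frame\<close> come in pairs, one for each orthogonal summand of rank
  2, while its columns come in two halves, image and complement; hence this splitting and the
  next.\<close>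

lemma sum_lessThan_pairs:
  fixes f :: "nat \<Rightarrow> 'a::comm_monoid_add"
  shows "(\<Sum>r<2 * m. f r) = (\<Sum>p<m. f (2 * p) + f (Suc (2 * p)))"
  by (induction m) (simp_all add: add_ac)

lemma sum_lessThan_halves:
  fixes f :: "nat \<Rightarrow> 'a::comm_monoid_add"
  shows "(\<Sum>r<2 * n. f r) = (\<Sum>l<n. f l) + (\<Sum>l<n. f (n + l))"
proof -
  have "(\<Sum>r=n..<2 * n. f r) = (\<Sum>l<n. f (n + l))"
    unfolding lessThan_atLeast0 using sum.shift_bounds_nat_ivl[of f 0 n n]
    by (simp add: add.commute mult_2)
  then show ?thesis
    by (simp add: sum_lessThan_split[of n "2 * n"])
qed

lemma sum_mid_left: "a < m \<Longrightarrow> (\<Sum>r<m. mid a r * v r) = v a"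
  using mprod_mid_left[of a m "\<lambda>r _. v r"] by (simp add: mprod_def)

lemma sum_mid_right: "a < m \<Longrightarrow> (\<Sum>r<m. v r * mid r a) = v a"
  using mprod_mid_right[of a m "\<lambda>_ r. v r"] by (simp add: mprod_def)

lemma sum_mid_left_if: "(\<Sum>r<m. mid r a * v r) = (if a < m then v a else 0)"
  by (simp add: mid_def if_distrib[of "\<lambda>x. x * _"] cong: if_cong)

text \<open>With respect to the decomposition \<open>H\<^sup>t \<bottom> \<langle>1,-1\<rangle>\<close>, column \<open>c < t\<close> is the vector
  \<open>e\<^sub>c + \<Sum>\<^sub>b R b c f\<^sub>b\<close>, column \<open>t\<close> is \<open>(y, z) + \<Sum>\<^sub>b R b t f\<^sub>b\<close>, and the remaining columns
  are the \<open>f\<^sub>b\<close> and \<open>(y', z')\<close>.\<close>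

definition frame :: "nat \<Rightarrow> (nat \<Rightarrow> nat \<Rightarrow> int) \<Rightarrow> int \<Rightarrow> int \<Rightarrow> int \<Rightarrow> int \<Rightarrow> nat \<Rightarrow> nat \<Rightarrow> int" where
  "frame t R y z y' z' r c =
     (if r div 2 = t then
        (if even r then y * mid t c + y' * mid (2 * t + 1) c else z * mid t c + z' * mid (2 * t + 1) c)
      else if even r then mid (r div 2) c
      else if c \<le> t then R (r div 2) c else mid (Suc t + r div 2) c)"

text \<open>The rows \<open>c \<le> t\<close> of the inverse of \<open>frame\<close>, separate
  because the rows belonging to the \<open>f\<^sub>b\<close> subtract multiples of them. Row
  \<open>t\<close> comes from the inverse of the 2 x 2 matrix with columns \<open>(y, z)\<close> and
  \<open>(y', z')\<close>, of determinant \<open>1\<close>.\<close>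

definition coframe_top :: "nat \<Rightarrow> int \<Rightarrow> int \<Rightarrow> nat \<Rightarrow> nat \<Rightarrow> int" where
  "coframe_top t y' z' c r =
     (if c = t then z' * mid (2 * t) r - y' * mid (2 * t + 1) r else mid (2 * c) r)"

text \<open>The inverse of \<open>frame\<close> when \<open>y * z' - z * y' = 1\<close>: it computes
  the coefficients of a vector in the columns of \<open>frame\<close>. The coefficient of
  \<open>f\<^sub>b\<close> is the \<open>f\<^sub>b\<close>-coordinate minus what the first
  \<open>t + 1\<close> columns contribute through \<open>R\<close>.\<close>

definition coframe :: "nat \<Rightarrow> (nat \<Rightarrow> nat \<Rightarrow> int) \<Rightarrow> int \<Rightarrow> int \<Rightarrow> int \<Rightarrow> int \<Rightarrow> nat \<Rightarrow> nat \<Rightarrow> int" where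
  "coframe t R y z y' z' c r =
     (if c \<le> t then coframe_top t y' z' c r
      else if c = 2 * t + 1 then y * mid (2 * t + 1) r - z * mid (2 * t) r
      else mid (2 * (c - Suc t) + 1) r - (\<Sum>l<Suc t. R (c - Suc t) l * coframe_top t y' z' l r))"

lemma frame_rows:
  "frame t R y z y' z' (2 * t) c = y * mid t c + y' * mid (2 * t + 1) c"
  "frame t R y z y' z' (Suc (2 * t)) c = z * mid t c + z' * mid (2 * t + 1) c"
  "b < t \<Longrightarrow> frame t R y z y' z' (2 * b) c = mid b c"
  "b < t \<Longrightarrow> frame t R y z y' z' (Suc (2 * b)) c = (if c \<le> t then R b c else mid (Suc t + b) c)"
  by (simp_all add: frame_def)

lemma coframe_rows:
  "b < t \<Longrightarrow> coframe t R y z y' z' b r = mid (2 * b) r"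
  "coframe t R y z y' z' t r = z' * mid (2 * t) r - y' * mid (2 * t + 1) r"
  "b < t \<Longrightarrow> coframe t R y z y' z' (Suc t + b) r =
     mid (2 * b + 1) r - (\<Sum>l<Suc t. R b l * coframe_top t y' z' l r)"
  "coframe t R y z y' z' (Suc t + t) r = y * mid (2 * t + 1) r - z * mid (2 * t) r"
  by (simp_all add: coframe_def coframe_top_def)

lemma coframe_top_apply:
  assumes "c \<le> t"
  shows "(\<Sum>r<2 * Suc t. coframe_top t y' z' c r * v r) =
    (if c = t then z' * v (2 * t) - y' * v (Suc (2 * t)) else v (2 * c))"
proof -
  have "(\<Sum>r<2 * Suc t. (z' * mid (2 * t) r - y' * mid (2 * t + 1) r) * v r) =
      z' * (\<Sum>r<2 * Suc t. mid (2 * t) r * v r) - y' * (\<Sum>r<2 * Suc t. mid (2 * t + 1) r * v r)"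
    unfolding sum_distrib_left sum_subtractf[symmetric]
    by (intro sum.cong) (simp_all add: algebra_simps)
  also have "\<dots> = z' * v (2 * t) - y' * v (Suc (2 * t))"
    using sum_mid_left[of "2 * t" "2 * Suc t" v] sum_mid_left[of "2 * t + 1" "2 * Suc t" v] by simp
  finally show ?thesis
    using assms sum_mid_left[of "2 * c" "2 * Suc t" v] by (simp add: coframe_top_def)
qed

lemma nat_pair_cases:
  assumes "i < 2 * Suc t"
  obtains (even) b where "b < t" "i = 2 * b" | (odd) b where "b < t" "i = Suc (2 * b)"
    | (even_last) "i = 2 * t" | (odd_last) "i = Suc (2 * t)"
  using assms that by (cases "even i") (auto elim!: evenE oddE simp: less_Suc_eq)

lemma nat_half_cases:
  assumes "i < 2 * Suc t"
  obtains (low) "i < t" | (low_last) "i = t" | (high) b where "b < t" "i = Suc t + b"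
    | (high_last) "i = Suc t + t"
proof -
  consider "i < t" | "i = t" | "t < i" by linarith
  then show ?thesis
  proof cases
    case 3
    then obtain b where "i = Suc t + b" using less_imp_Suc_add by auto
    with assms that show ?thesis by (cases "b = t") auto
  qed (use that in auto)
qed

text \<open>By type of row: in the row of \<open>f\<^sub>b\<close> the entries \<open>R\<close>
  cancel the correction built into \<open>coframe\<close>, and the last two rows reduce to the 2 x 2
  inverse.\<close>

lemma frame_coframe:
  assumes det: "y * z' - z * y' = 1" and i: "i < 2 * Suc t" and j: "j < 2 * Suc t"
  shows "mprod (2 * Suc t) (frame t R y z y' z') (coframe t R y z y' z') i j = mid i j"
proof -
  let ?C = "frame t R y z y' z'" and ?W = "coframe t R y z y' z'"
  have sum: "mprod (2 * Suc t) ?C ?W i j =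
      (\<Sum>l<t. ?C i l * ?W l j) + ?C i t * ?W t j +
      ((\<Sum>l<t. ?C i (Suc t + l) * ?W (Suc t + l) j) + ?C i (Suc t + t) * ?W (Suc t + t) j)"
    unfolding mprod_def sum_lessThan_halves by simp
  from i show ?thesis
  proof (cases rule: nat_pair_cases)
    case (even b)
    then have "(\<Sum>l<t. ?C i l * ?W l j) = ?W b j"
      by (simp add: frame_rows sum_mid_left)
    with even show ?thesis
      unfolding sum by (simp add: frame_rows coframe_rows(1)) (simp add: mid_def)
  next
    case (odd b)
    have "(\<Sum>l<t. ?C i l * ?W l j) + ?C i t * ?W t j = (\<Sum>l<Suc t. R b l * coframe_top t y' z' l j)"
      using odd by (simp add: frame_rows coframe_def)
    moreover have "(\<Sum>l<t. ?C i (Suc t + l) * ?W (Suc t + l) j) = (\<Sum>l<t. mid b l * ?W (Suc t + l) j)"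
      using odd by (intro sum.cong) (auto simp: frame_rows mid_def)
    moreover have "\<dots> = ?W (Suc t + b) j"
      using odd by (simp add: sum_mid_left)
    moreover have "?C i (Suc t + t) = 0"
      using odd by (simp add: frame_rows mid_def)
    ultimately show ?thesis
      unfolding sum using odd by (simp add: coframe_rows(3) del: sum.lessThan_Suc add_Suc)
  next
    case even_last
    then have "?C i l = 0" "?C i (Suc t + l) = 0" if "l < t" for l
      using that by (simp_all add: frame_rows mid_def)
    then have "mprod (2 * Suc t) ?C ?W i j = y * ?W t j + y' * ?W (Suc t + t) j"
      unfolding sum using even_last by (simp add: frame_rows mid_def)
    also have "\<dots> = (y * z' - z * y') * mid (2 * t) j"
      by (simp only: coframe_rows) (simp add: algebra_simps)
    finally show ?thesis using det even_last by simp
  next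
    case odd_last
    then have "?C i l = 0" "?C i (Suc t + l) = 0" if "l < t" for l
      using that by (simp_all add: frame_rows mid_def)
    then have "mprod (2 * Suc t) ?C ?W i j = z * ?W t j + z' * ?W (Suc t + t) j"
      unfolding sum using odd_last by (simp add: frame_rows mid_def)
    also have "\<dots> = (y * z' - z * y') * mid (2 * t + 1) j"
      by (simp only: coframe_rows) (simp add: algebra_simps)
    finally show ?thesis using det odd_last by simp
  qed
qed

lemma coframe_frame:
  assumes det: "y * z' - z * y' = 1" and i: "i < 2 * Suc t" and j: "j < 2 * Suc t"
  shows "mprod (2 * Suc t) (coframe t R y z y' z') (frame t R y z y' z') i j = mid i j"
proof -
  let ?C = "frame t R y z y' z'" and ?W = "coframe t R y z y' z'"
  \<comment> \<open>The first \<open>t + 1\<close> rows of \<open>coframe\<close> already produce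
    rows of the identity; this evaluates the sums subtracted in the lower rows.\<close>
  have top: "(\<Sum>r<2 * Suc t. coframe_top t y' z' c r * ?C r j) = mid c j" if "c \<le> t" for c
  proof (cases "c = t")
    case True
    have "z' * ?C (2 * t) j - y' * ?C (Suc (2 * t)) j = (y * z' - z * y') * mid t j"
      unfolding frame_rows by (simp add: algebra_simps)
    with True det show ?thesis
      by (simp add: coframe_top_apply del: mult_Suc_right)
  next
    case False
    with that show ?thesis
      by (simp add: coframe_top_apply frame_rows del: mult_Suc_right)
  qed
  show ?thesis
  proof (cases "i \<le> t")
    case True
    then show ?thesis
      using top[OF True] by (simp add: mprod_def coframe_def del: mult_Suc_right)
  next
    case False
    then obtain b where b: "i = Suc t + b" "b \<le> t"
      using less_imp_Suc_add[of t i] i by auto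
    show ?thesis
    proof (cases "b = t")
      case True
      have "mprod (2 * Suc t) ?W ?C i j =
          y * (\<Sum>r<2 * Suc t. mid (2 * t + 1) r * ?C r j) - z * (\<Sum>r<2 * Suc t. mid (2 * t) r * ?C r j)"
        unfolding mprod_def sum_distrib_left sum_subtractf[symmetric] b(1) True coframe_rows
        by (intro sum.cong) (simp_all add: algebra_simps)
      also have "\<dots> = y * ?C (Suc (2 * t)) j - z * ?C (2 * t) j"
        using sum_mid_left[of "2 * t" "2 * Suc t" "\<lambda>r. ?C r j"]
          sum_mid_left[of "2 * t + 1" "2 * Suc t" "\<lambda>r. ?C r j"] by simp
      also have "\<dots> = (y * z' - z * y') * mid (2 * t + 1) j"
        unfolding frame_rows by (simp add: algebra_simps)
      finally show ?thesis
        using det b True by (simp add: mult_2)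
    next
      case False
      with b have bt: "b < t" by simp
      have "mprod (2 * Suc t) ?W ?C i j = (\<Sum>r<2 * Suc t. mid (2 * b + 1) r * ?C r j) -
          (\<Sum>r<2 * Suc t. \<Sum>l<Suc t. R b l * (coframe_top t y' z' l r * ?C r j))"
        unfolding mprod_def sum_subtractf[symmetric] b(1) coframe_rows(3)[OF bt]
        by (intro sum.cong) (simp_all add: left_diff_distrib sum_distrib_right mult.assoc
            del: sum.lessThan_Suc)
      also have "(\<Sum>r<2 * Suc t. \<Sum>l<Suc t. R b l * (coframe_top t y' z' l r * ?C r j)) =
          (\<Sum>l<Suc t. R b l * (\<Sum>r<2 * Suc t. coframe_top t y' z' l r * ?C r j))"
        unfolding sum_distrib_left by (rule sum.swap)
      also have "\<dots> = (\<Sum>l<Suc t. R b l * mid l j)"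
        by (intro sum.cong) (simp_all add: top del: mult_Suc_right)
      also have "\<dots> = (if j \<le> t then R b j else 0)"
      proof (cases "j \<le> t")
        case True
        then show ?thesis
          using sum_mid_right[of j "Suc t" "R b"] by (simp del: sum.lessThan_Suc)
      qed (auto simp: mid_def intro!: sum.neutral)
      also have "(\<Sum>r<2 * Suc t. mid (2 * b + 1) r * ?C r j) = ?C (Suc (2 * b)) j"
        using sum_mid_left[of "2 * b + 1" "2 * Suc t" "\<lambda>r. ?C r j"] bt by simp
      finally show ?thesis
        using bt b by (auto simp: frame_rows mid_def)
    qed
  qed
qed

text \<open>Each row of this Gram matrix has a single nonzero entry: the sign \<open>s\<close>, in
  column \<open>p\<close>.\<close>

lemma H_perp_gram_apply:
  assumes "a < 2 * Suc t"
  shows "(\<Sum>b<2 * Suc t. H_perp_gram (Suc t) a b k * v b) =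
    (if a < 2 * t then if even a then v (Suc a) else v (a - 1) else if a = 2 * t then v a else - v a)"
proof -
  define p where "p = (if a < 2 * t then if even a then Suc a else a - 1 else a)"
  define s :: int where "s = (if a = 2 * t + 1 then -1 else 1)"
  have p: "p < 2 * Suc t"
    using assms by (auto simp: p_def)
  have "H_perp_gram (Suc t) a b k = s * mid p b" if "b < 2 * Suc t" for b
  proof -
    have "a div 2 = b div 2 \<and> a \<noteq> b \<longleftrightarrow> p = b" if "a < 2 * t"
      using that unfolding p_def by (cases "even a") (auto elim!: evenE oddE)
    moreover have "p < 2 * t" if "a < 2 * t"
      using that unfolding p_def by (cases "even a") (auto elim!: evenE oddE)
    ultimately show ?thesis
      using assms that by (auto simp: H_perp_gram_def z2_const_def s_def mid_def p_def)
  qed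
  then have "(\<Sum>b<2 * Suc t. H_perp_gram (Suc t) a b k * v b) = s * (\<Sum>b<2 * Suc t. mid p b * v b)"
    unfolding sum_distrib_left by (intro sum.cong) auto
  also have "\<dots> = s * v p"
    using p by (simp only: sum_mid_left)
  finally show ?thesis
    using assms by (auto simp: p_def s_def)
qed

text \<open>The \<open>e\<^sub>i\<close> are isotropic and mutually orthogonal, so each product
  comes from pairing \<open>e\<^sub>i\<close> with the \<open>f\<^sub>i\<close> part of the other
  column. Off the diagonal \<open>R\<close> can realise any value, but for \<open>i < t\<close> the
  norm is \<open>2 * R i i\<close>; this is why these norms must be even.\<close>

lemma frame_gram:
  assumes i: "i \<le> t" and j: "j \<le> t"
  shows "mprod (2 * Suc t) (mtr (frame t R y z y' z'))
      (mprod (2 * Suc t) (\<lambda>a b. H_perp_gram (Suc t) a b k) (frame t R y z y' z')) i j =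
    (if i < t then R i j else 0) + (if j < t then R j i else 0) +
    (if i = t \<and> j = t then y * y - z * z else 0)"
proof -
  let ?C = "frame t R y z y' z'"
  have "mprod (2 * Suc t) (mtr ?C) (mprod (2 * Suc t) (\<lambda>a b. H_perp_gram (Suc t) a b k) ?C) i j =
      (\<Sum>a<2 * Suc t. ?C a i * (if a < 2 * t then if even a then ?C (Suc a) j else ?C (a - 1) j
         else if a = 2 * t then ?C a j else - ?C a j))"
    unfolding mprod_def mtr_def by (intro sum.cong) (simp_all add: H_perp_gram_apply del: mult_Suc_right)
  also have "\<dots> = (\<Sum>p<t. ?C (2 * p) i * ?C (Suc (2 * p)) j + ?C (Suc (2 * p)) i * ?C (2 * p) j) +
      (?C (2 * t) i * ?C (2 * t) j - ?C (Suc (2 * t)) i * ?C (Suc (2 * t)) j)"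
    unfolding sum_lessThan_pairs by simp
  also have "(\<Sum>p<t. ?C (2 * p) i * ?C (Suc (2 * p)) j + ?C (Suc (2 * p)) i * ?C (2 * p) j) =
      (\<Sum>p<t. mid p i * R p j + mid p j * R p i)"
    using i j by (intro sum.cong) (simp_all add: frame_rows)
  also have "\<dots> = (if i < t then R i j else 0) + (if j < t then R j i else 0)"
    by (simp add: sum.distrib sum_mid_left_if)
  also have "?C (2 * t) i * ?C (2 * t) j - ?C (Suc (2 * t)) i * ?C (Suc (2 * t)) j =
      (if i = t \<and> j = t then y * y - z * z else 0)"
    using i j by (auto simp: frame_rows mid_def)
  finally show ?thesis .
qed

section \<open>2-adic halves, quadratic roots and norms in the plane with diagonal 1, -1\<close>

text \<open>Halving costs one binary digit, so level \<open>k\<close> of the half is read off from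
  level \<open>Suc k\<close>.\<close>

lemma z2_valid_half:
  assumes x: "z2_valid x" and even: "even (x 1)"
  shows "z2_valid (\<lambda>k. x (Suc k) div 2)" and "2 * (x (Suc k) div 2) = x (Suc k)"
proof -
  have half: "2 * (x (Suc k) div 2) = x (Suc k)" for k
  proof -
    have "[x (Suc k) = x 1] (mod 2 ^ 1)"
      using x by (rule z2_valid_le) simp
    with even show ?thesis
      using cong_dvd_iff[of "x (Suc k)" "x 1" 2] by simp
  qed
  have "2 ^ k dvd x (Suc (Suc k)) div 2 - x (Suc k) div 2" for k
  proof -
    have "2 ^ Suc k dvd x (Suc (Suc k)) - x (Suc k)"
      using x by (simp add: z2_valid_def cong_iff_dvd_diff del: power_Suc)
    also have "x (Suc (Suc k)) - x (Suc k) = 2 * (x (Suc (Suc k)) div 2 - x (Suc k) div 2)"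
      by (simp only: half right_diff_distrib)
    finally show ?thesis by (simp del: right_diff_distrib_numeral)
  qed
  then show "z2_valid (\<lambda>k. x (Suc k) div 2)"
    by (simp add: z2_valid_def cong_iff_dvd_diff)
  show "2 * (x (Suc k) div 2) = x (Suc k)"
    by (rule half)
qed

text \<open>The root is the limit of iterating \<open>r \<mapsto> c - r * r\<close> from
  \<open>0\<close>. All iterates are even, so in the difference of two consecutive squares the
  factor \<open>s (Suc k) + s k\<close> gains a power of \<open>2\<close> at each stage.\<close>

lemma z2_quadratic_root:
  assumes c: "z2_valid c" and even: "\<And>k. even (c k)"
  obtains s where "z2_valid s" "\<And>k. [s k * s k + s k = c k] (mod 2 ^ k)"
proof
  define s :: z2 where "s = rec_nat 0 (\<lambda>k r. c (Suc k) - r * r)"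
  have s_Suc: "s (Suc k) = c (Suc k) - s k * s k" for k
    by (simp add: s_def)
  have s_even: "even (s k)" for k
    by (induction k) (use even in \<open>simp_all add: s_Suc\<close>, simp add: s_def)
  have s: "2 ^ k dvd s (Suc k) - s k" for k
  proof (induction k)
    case (Suc k)
    have "2 ^ k * 2 dvd (s (Suc k) - s k) * (s (Suc k) + s k)"
      using Suc s_even by (intro mult_dvd_mono) auto
    moreover have "2 ^ Suc k dvd c (Suc (Suc k)) - c (Suc k)"
      using c by (simp add: z2_valid_def cong_iff_dvd_diff del: power_Suc)
    moreover have "s (Suc (Suc k)) - s (Suc k) =
        (c (Suc (Suc k)) - c (Suc k)) - (s (Suc k) - s k) * (s (Suc k) + s k)"
      by (subst s_Suc, subst (2) s_Suc) (simp add: algebra_simps)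
    ultimately show ?case
      by (metis dvd_diff power_Suc2)
  qed simp
  then show "z2_valid s"
    by (simp add: z2_valid_def cong_iff_dvd_diff)
  show "[s k * s k + s k = c k] (mod 2 ^ k)" for k
  proof -
    \<comment> \<open>By the recursion this difference equals
      \<open>s k * s k + s k - c k\<close>.\<close>
    have "2 ^ k dvd (c (Suc k) - c k) - (s (Suc k) - s k)"
      using c s by (intro dvd_diff[of _ "c (Suc k) - c k"]) (auto simp: z2_valid_def cong_iff_dvd_diff)
    then show ?thesis
      by (simp add: cong_iff_dvd_diff s_Suc algebra_simps)
  qed
qed

text \<open>For odd \<open>a\<close> use \<open>(z + 1)^2 - z^2 = 2 z + 1\<close>; for
  \<open>a\<close> divisible by \<open>8\<close> use \<open>(1 + 2 s)^2 - 1 = 4 (s^2 + s)\<close>,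
  where \<open>s^2 + s = a / 4\<close> is solvable because \<open>a / 4\<close> is even. The pair
  \<open>(y', z')\<close> completes \<open>(y, z)\<close> to a basis, which makes the vector
  primitive.\<close>

lemma hyperbolic_norm:
  assumes a: "z2_valid a" and norm: "odd (a 1) \<or> 8 dvd a 3"
  obtains y z y' z' where "z2_valid y" "z2_valid z" "z2_valid y'" "z2_valid z'"
    "\<And>k. y k * z' k - z k * y' k = 1" "\<And>k. [y k * y k - z k * z k = a k] (mod 2 ^ k)"
proof (cases "odd (a 1)")
  case True
  define b where "b k = a k - 1" for k
  have b: "z2_valid b" "even (b 1)"
    using a True by (auto simp: b_def[abs_def] intro: z2_valid_intros)
  define z where "z k = b (Suc k) div 2" for k
  have z: "z2_valid z"
    unfolding z_def[abs_def] by (rule z2_valid_half(1)[OF b])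
  show thesis
  proof (rule that[of "\<lambda>k. z k + 1" z "\<lambda>_. 1" "\<lambda>_. 1"])
    have "(z k + 1) * (z k + 1) - z k * z k = a (Suc k)" for k
      using z2_valid_half(2)[OF b, of k] by (simp add: algebra_simps z_def b_def)
    with a show "[(z k + 1) * (z k + 1) - z k * z k = a k] (mod 2 ^ k)" for k
      by (simp add: z2_valid_def)
  qed (auto intro!: z2_valid_intros z)
next
  case False
  with norm have a8: "8 dvd a 3" by simp
  have a8: "8 dvd a (k + 3)" for k
    using z2_valid_le[OF a, of 3 "k + 3"] a8 cong_dvd_iff[of "a (k + 3)" "a 3" 8] by simp
  \<comment> \<open>From level \<open>3\<close> on, the representatives of \<open>a\<close> are
    multiples of \<open>8\<close> as integers, so this quotient is exact and even at every
    level.\<close>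
  define c where "c k = a (k + 3) div 4" for k
  have c4: "4 * c k = a (k + 3)" for k
    using a8[of k] unfolding c_def by presburger
  have "even (c k)" for k
    using a8[of k] unfolding c4[symmetric] by presburger
  moreover have "z2_valid c"
    unfolding z2_valid_def
  proof
    fix k
    have "2 ^ (k + 3) dvd a (Suc (k + 3)) - a (k + 3)"
      using a unfolding z2_valid_def cong_iff_dvd_diff by blast
    also have "a (Suc (k + 3)) - a (k + 3) = 4 * (c (Suc k) - c k)"
      by (simp add: right_diff_distrib c4)
    finally have "4 * (2 * 2 ^ k) dvd 4 * (c (Suc k) - c k)"
      by (simp only: power_add) (simp add: mult.commute del: right_diff_distrib_numeral)
    then have "2 * 2 ^ k dvd c (Suc k) - c k"
      by (simp only: dvd_mult_cancel_left) simp
    then show "[c (Suc k) = c k] (mod 2 ^ k)"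
      by (simp add: cong_iff_dvd_diff dvd_mult_right)
  qed
  ultimately obtain s where s: "z2_valid s" and root: "\<And>k. [s k * s k + s k = c k] (mod 2 ^ k)"
    by (metis z2_quadratic_root)
  show thesis
  proof (rule that[of "\<lambda>k. 1 + 2 * s k" "\<lambda>_. 1" "\<lambda>_. -1" "\<lambda>_. 0"])
    show "[(1 + 2 * s k) * (1 + 2 * s k) - 1 * 1 = a k] (mod 2 ^ k)" for k
    proof -
      have "(1 + 2 * s k) * (1 + 2 * s k) - 1 * 1 = 4 * (s k * s k + s k)"
        by (simp add: algebra_simps)
      also have "[\<dots> = 4 * c k] (mod 2 ^ k)"
        using root by (intro cong_mult) auto
      also have "4 * c k = a (k + 3)" by (rule c4)
      also have "[\<dots> = a k] (mod 2 ^ k)"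
        using a by (rule z2_valid_le) simp
      finally show ?thesis .
    qed
  qed (auto intro!: z2_valid_intros s)
qed

section \<open>Lattices with one distinguished basis vector\<close>

lemma prim_rep_normal_form:
  assumes valid: "valid_mat (Suc t) (Suc t) A"
    and sym: "\<And>i j. i \<le> t \<Longrightarrow> j \<le> t \<Longrightarrow> z2_eq (A i j) (A j i)"
    and even: "\<And>i. i < t \<Longrightarrow> even (A i i 1)"
    and norm: "odd (A t t 1) \<or> 8 dvd A t t 3"
  shows "prim_rep (2 * Suc t) (H_perp_gram (Suc t)) (Suc t) A"
proof -
  have valid': "z2_valid (A i j)" if "i \<le> t" "j \<le> t" for i j
    using valid that by (simp add: valid_mat_def)
  obtain y z y' z' where yz: "z2_valid y" "z2_valid z" "z2_valid y'" "z2_valid z'"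
    and det: "\<And>k. y k * z' k - z k * y' k = 1"
    and yz_norm: "\<And>k. [y k * y k - z k * z k = A t t k] (mod 2 ^ k)"
    using hyperbolic_norm[OF valid' norm] by blast
  \<comment> \<open>Zero below the diagonal lets \<open>R k i j + R k j i\<close> count each
    off-diagonal product once; on the diagonal half the norm is counted twice.\<close>
  define R where "R k b l = (if b < l then A b l k else if b = l then A b b (Suc k) div 2 else 0)"
    for k b l
  have R: "z2_valid (\<lambda>k. R k b l)" if "b < t" "l \<le> t" for b l
    unfolding R_def using that
    by (auto intro!: z2_valid_if z2_valid_const valid' z2_valid_half(1) even)
  define C where "C k = frame t (R k) (y k) (z k) (y' k) (z' k)" for k
  define W where "W k = coframe t (R k) (y k) (z k) (y' k) (z' k)" for k
  define X Y :: z2mat where "X i j k = C k i j" and "Y i j k = C k i (Suc t + j)" for i j k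
  have C: "z2_valid (\<lambda>k. C k i j)" if "i < 2 * Suc t" for i j
    using that by (cases rule: nat_pair_cases)
      (auto simp: C_def frame_rows intro!: z2_valid_intros yz R)
  have top: "z2_valid (\<lambda>k. coframe_top t (y' k) (z' k) c r)" for c r
    unfolding coframe_top_def by (intro z2_valid_intros yz)
  have "z2_valid (\<lambda>k. W k i j)" if "i < 2 * Suc t" for i j
    using that by (cases rule: nat_half_cases)
      (auto simp: W_def coframe_rows simp del: sum.lessThan_Suc add_Suc intro!: z2_valid_intros yz R top)
  then have "valid_mat (2 * Suc t) (2 * Suc t) (\<lambda>i j k. W k i j)"
    unfolding valid_mat_def by simp
  moreover have "valid_mat (2 * Suc t) (2 * Suc t - Suc t) Y"
    unfolding valid_mat_def Y_def by (simp add: C)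
  moreover have "(\<lambda>i j. if j < Suc t then X i j k else Y i (j - Suc t) k) = C k" for k
    by (intro ext) (simp add: X_def Y_def)
  moreover have "mcong q (2 * Suc t) (2 * Suc t) (mprod (2 * Suc t) (C k) (W k)) mid"
    and "mcong q (2 * Suc t) (2 * Suc t) (mprod (2 * Suc t) (W k) (C k)) mid" for q k
    unfolding mcong_def C_def W_def using frame_coframe[OF det] coframe_frame[OF det] by auto
  ultimately have "z2_primitive (2 * Suc t) (Suc t) X"
    unfolding z2_primitive_iff by (intro conjI exI[of _ Y] exI[of _ "\<lambda>i j k. W k i j"]) auto
  moreover have "z2_represents (2 * Suc t) (H_perp_gram (Suc t)) (Suc t) A X"
    unfolding z2_represents_iff
  proof (intro conjI allI)
    show "valid_mat (2 * Suc t) (Suc t) X"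
      unfolding valid_mat_def X_def by (simp add: C)
  next
    fix k
    have sym': "[A i j k = A j i k] (mod 2 ^ k)" if "i \<le> t" "j \<le> t" for i j
      using sym[OF that] by (simp add: z2_eq_def)
    have "[(if i < t then R k i j else 0) + (if j < t then R k j i else 0) +
        (if i = t \<and> j = t then y k * y k - z k * z k else 0) = A i j k] (mod 2 ^ k)"
      if "i \<le> t" "j \<le> t" for i j
    proof (cases i j rule: linorder_cases)
      case equal
      show ?thesis
      proof (cases "i = t")
        case True
        with equal yz_norm show ?thesis by simp
      next
        case False
        then have "[2 * (A i i (Suc k) div 2) = A i i k] (mod 2 ^ k)"
          using z2_valid_half(2)[OF valid' even, of i k] valid'[of i i] that
          by (simp add: z2_valid_def)
        with False equal that show ?thesis by (simp add: R_def)
      qed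
    qed (use that sym' in \<open>auto simp: R_def\<close>)
    then show "mcong (2 ^ k) (Suc t) (Suc t) (mprod (2 * Suc t) (mtr (\<lambda>i j. X i j k))
        (mprod (2 * Suc t) (\<lambda>i j. H_perp_gram (Suc t) i j k) (\<lambda>i j. X i j k))) (\<lambda>i j. A i j k)"
      unfolding mcong_def X_def C_def by (simp add: frame_gram del: mult_Suc_right)
  qed
  ultimately show ?thesis
    unfolding prim_rep_def by blast
qed

section \<open>Vectors of norm divisible by 8 in even forms\<close>

text \<open>An even square coefficient settles it with one variable. If all three are odd, an even
  mixed coefficient allows the sum of two variables; if the mixed ones are odd too, the sum of all
  three takes a value with six odd terms.\<close>

lemma ternary_even_value:
  fixes p q r a b c :: int
  obtains x y z where "x \<in> {0, 1}" "y \<in> {0, 1}" "z \<in> {0, 1}" "x = 1 \<or> y = 1 \<or> z = 1"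
    and "even (x * p + y * q + z * r + x * y * a + x * z * b + y * z * c)"
proof -
  note rule = that
  consider "even p" | "even q" | "even r" | "odd p" "odd q" "odd a" "odd r" "odd b" "odd c"
    | "odd p" "odd q" "even a" | "odd p" "odd r" "even b" | "odd q" "odd r" "even c"
    by blast
  then show thesis
  proof cases
    case 1 then show thesis using rule[of 1 0 0] by simp
  next
    case 2 then show thesis using rule[of 0 1 0] by simp
  next
    case 3 then show thesis using rule[of 0 0 1] by simp
  next
    case 4 then show thesis using rule[of 1 1 1] by simp
  next
    case 5 then show thesis using rule[of 1 1 0] by simp
  next
    case 6 then show thesis using rule[of 1 0 1] by simp
  next
    case 7 then show thesis using rule[of 0 1 1] by simp
  qed
qed

definition bil :: "nat \<Rightarrow> (nat \<Rightarrow> nat \<Rightarrow> int) \<Rightarrow> (nat \<Rightarrow> int) \<Rightarrow> (nat \<Rightarrow> int) \<Rightarrow> int" where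
  "bil n M x y = (\<Sum>a<n. \<Sum>b<n. x a * M a b * y b)"

lemma bil_add_left: "bil n M (\<lambda>i. x i + y i) z = bil n M x z + bil n M y z"
  by (simp add: bil_def sum.distrib algebra_simps)

lemma bil_add_right: "bil n M x (\<lambda>i. y i + z i) = bil n M x y + bil n M x z"
  by (simp add: bil_def sum.distrib algebra_simps)

lemma bil_scale_left: "bil n M (\<lambda>i. c * x i) y = c * bil n M x y"
  by (simp add: bil_def sum_distrib_left mult.assoc)

lemma bil_scale_right: "bil n M x (\<lambda>i. c * y i) = c * bil n M x y"
  by (simp add: bil_def sum_distrib_left algebra_simps)

lemma bil_commute:
  assumes "\<forall>a<n. \<forall>b<n. M a b = M b a"
  shows "bil n M x y = bil n M y x"
proof -
  have "bil n M x y = (\<Sum>b<n. \<Sum>a<n. x a * M a b * y b)"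
    unfolding bil_def by (rule sum.swap)
  also have "\<dots> = bil n M y x"
    unfolding bil_def using assms by (intro sum.cong) (auto simp: algebra_simps)
  finally show ?thesis .
qed

lemma bil_mid_right: "a < n \<Longrightarrow> bil n M x (mid a) = (\<Sum>c<n. x c * M c a)"
  by (simp add: bil_def mid_def if_distrib[of "\<lambda>x. _ * x"] cong: if_cong)

lemma bil_mid_mid:
  assumes "a < n" and "b < n"
  shows "bil n M (mid a) (mid b) = M a b"
proof -
  have "bil n M (mid a) (mid b) = mprod n mid M a b"
    using assms(2) by (simp add: bil_mid_right mprod_def)
  with assms(1) show ?thesis by (simp add: mprod_mid_left)
qed

lemma bil_eq_sum_right: "bil n M x y = (\<Sum>a<n. bil n M x (mid a) * y a)"
proof -
  have "bil n M x y = (\<Sum>a<n. \<Sum>c<n. x c * M c a * y a)"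
    unfolding bil_def by (rule sum.swap)
  then show ?thesis
    by (simp add: bil_mid_right sum_distrib_right)
qed

text \<open>Divided by \<open>2 * d\<close>, the norm form on the span of \<open>u\<close>,
  \<open>v\<close>, \<open>w\<close> is an integral ternary form, and its even value gains the extra
  factor \<open>2\<close>. It is used with \<open>d = 1\<close> on basis vectors and then with
  \<open>d = 2\<close>.\<close>

lemma bil_combination_dvd:
  assumes sym: "\<forall>a<n. \<forall>b<n. M a b = M b a"
    and norms: "2 * d dvd bil n M u u" "2 * d dvd bil n M v v" "2 * d dvd bil n M w w"
    and products: "d dvd bil n M u v" "d dvd bil n M u w" "d dvd bil n M v w"
  obtains x y z where "x \<in> {0, 1}" "y \<in> {0, 1}" "z \<in> {0, 1}" "x = 1 \<or> y = 1 \<or> z = 1"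
    and "4 * d dvd bil n M (\<lambda>i. x * u i + (y * v i + z * w i)) (\<lambda>i. x * u i + (y * v i + z * w i))"
proof -
  obtain p q r where pqr: "bil n M u u = 2 * d * p" "bil n M v v = 2 * d * q" "bil n M w w = 2 * d * r"
    using norms by (auto elim!: dvdE)
  obtain a b c where abc: "bil n M u v = d * a" "bil n M u w = d * b" "bil n M v w = d * c"
    using products by (auto elim!: dvdE)
  obtain x y z where xyz: "x \<in> {0, 1}" "y \<in> {0, 1}" "z \<in> {0, 1}" "x = 1 \<or> y = 1 \<or> z = 1"
    and even: "even (x * p + y * q + z * r + x * y * a + x * z * b + y * z * c)"
    by (rule ternary_even_value)
  note comm = bil_commute[OF sym]
  have "bil n M (\<lambda>i. x * u i + (y * v i + z * w i)) (\<lambda>i. x * u i + (y * v i + z * w i)) =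
      x * x * (2 * d * p) + y * y * (2 * d * q) + z * z * (2 * d * r) +
      2 * (x * y * (d * a) + x * z * (d * b) + y * z * (d * c))"
    unfolding bil_add_left bil_add_right bil_scale_left bil_scale_right
      comm[of v u] comm[of w u] comm[of w v] pqr abc
    by (simp add: algebra_simps)
  also have "\<dots> = (2 * d) * (x * p + y * q + z * r + x * y * a + x * z * b + y * z * c)"
  proof -
    have "x * x = x" "y * y = y" "z * z = z" using xyz by auto
    then show ?thesis by (simp only:) (simp add: algebra_simps)
  qed
  also have "2 * d * 2 dvd \<dots>"
    using even by (intro mult_dvd_mono) auto
  finally have "4 * d dvd bil n M (\<lambda>i. x * u i + (y * v i + z * w i)) (\<lambda>i. x * u i + (y * v i + z * w i))"
    by (simp add: mult.commute)
  with xyz that show thesis by blast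
qed

text \<open>Any three basis vectors from \<open>I\<close> will do, with \<open>d = 1\<close>. The
  coordinate \<open>1\<close> ensures primitivity; the control of the support serves to make several
  such vectors independent.\<close>

lemma unit_vector_norm_dvd_4:
  assumes sym: "\<forall>a<n. \<forall>b<n. M a b = M b a"
    and even: "\<forall>a<n. even (M a a)"
    and I: "I \<subseteq> {..<n}" "3 \<le> card I"
  obtains i x where "i \<in> I" "x i = 1" "\<forall>a. a \<notin> I \<longrightarrow> x a = 0" "4 dvd bil n M x x"
proof -
  obtain J where "J \<subseteq> I" "card J = 3"
    using I(2) by (meson obtain_subset_with_card_n)
  then obtain a b c where abc: "a \<noteq> b" "a \<noteq> c" "b \<noteq> c" "a \<in> I" "b \<in> I" "c \<in> I"
    by (auto simp: card_3_iff)
  then have less: "a < n" "b < n" "c < n" using I(1) by auto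
  have norm: "2 * 1 dvd bil n M (mid e) (mid e)" if "e < n" for e
    using that even by (simp add: bil_mid_mid)
  obtain x y z where xyz: "x = 1 \<or> y = 1 \<or> z = 1"
    and dvd: "4 * 1 dvd bil n M (\<lambda>i. x * mid a i + (y * mid b i + z * mid c i))
      (\<lambda>i. x * mid a i + (y * mid b i + z * mid c i))"
    by (rule bil_combination_dvd[OF sym norm[OF less(1)] norm[OF less(2)] norm[OF less(3)]
        one_dvd one_dvd one_dvd])
  define v where "v i = x * mid a i + (y * mid b i + z * mid c i)" for i
  have "v a = x" "v b = y" "v c = z"
    using abc by (simp_all add: v_def mid_def)
  with xyz obtain i where "i \<in> I" "v i = 1"
    using abc by metis
  moreover have "\<forall>e. e \<notin> I \<longrightarrow> v e = 0"
    using abc by (auto simp: v_def mid_def)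
  moreover have "4 dvd bil n M v v"
    using dvd by (simp add: v_def[abs_def])
  ultimately show thesis by (rule that)
qed

text \<open>A vector of norm \<open>4\<close> mod \<open>8\<close> that has an odd product with some \<open>e\<^sub>a\<close> can be corrected by
  \<open>2e\<^sub>a\<close>. Otherwise there are three independent vectors with norms in \<open>4\<int>\<close> and even mutual products,
  to which the ternary lemma applies once more after division by \<open>2\<close>.\<close>

lemma unit_vector_norm_dvd_8:
  assumes sym: "\<forall>a<n. \<forall>b<n. M a b = M b a"
    and even: "\<forall>a<n. even (M a a)"
    and n: "5 \<le> n"
  obtains i x where "i < n" "x i = 1" "8 dvd bil n M x x"
proof -
  have correct: "\<exists>i x. i < n \<and> x i = 1 \<and> 8 dvd bil n M x x"
    if i: "i < n" "x i = 1" and norm: "4 dvd bil n M x x" and a: "a < n" and odd: "odd (bil n M x (mid a))"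
    for i a x
  proof (cases "8 dvd bil n M x x")
    case False
    \<comment> \<open>The sign keeps coordinate \<open>i\<close> equal to \<open>1\<close> even when
      \<open>a = i\<close>, since \<open>-1 + 2 = 1\<close>.\<close>
    define e :: int where "e = (if a = i then -1 else 1)"
    let ?v = "\<lambda>j. e * x j + 2 * mid a j"
    have "bil n M ?v ?v = e * e * bil n M x x + 4 * e * bil n M x (mid a) + 4 * M a a"
      unfolding bil_add_left bil_add_right bil_scale_left bil_scale_right
        bil_commute[OF sym, of "mid a" x] bil_mid_mid[OF a a] by simp
    also have "e * e = 1" by (simp add: e_def)
    finally have v: "bil n M ?v ?v = bil n M x x + 4 * e * bil n M x (mid a) + 4 * M a a" by simp
    obtain p where p: "bil n M x x = 4 * p" using norm by (elim dvdE)
    with False have "odd p" by presburger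
    moreover have "odd (e * bil n M x (mid a))" using odd by (simp add: e_def)
    moreover have "even (M a a)" using even a by simp
    ultimately have "even (p + e * bil n M x (mid a) + M a a)" by simp
    then have "4 * 2 dvd 4 * (p + e * bil n M x (mid a) + M a a)"
      by (rule mult_dvd_mono[OF dvd_refl])
    then have "8 dvd bil n M ?v ?v"
      unfolding v p by (simp add: algebra_simps)
    moreover have "?v i = 1"
      using i by (simp add: e_def mid_def)
    ultimately show ?thesis using i(1) by (intro exI[of _ i] exI[of _ ?v]) simp
  qed (use i in blast)
  have "\<exists>i x. i < n \<and> x i = 1 \<and> 8 dvd bil n M x x"
  proof (rule ccontr)
    assume none: "\<not> ?thesis"
    \<comment> \<open>By \<open>correct\<close>, such a vector has even product with every
      \<open>mid a\<close>, hence with every vector.\<close>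
    have radical: "2 dvd bil n M x y" if "i < n" "x i = 1" "4 dvd bil n M x x" for i x y
      unfolding bil_eq_sum_right[of n M x y]
      using correct[of i x] that none by (intro dvd_sum dvd_mult2) blast
    let ?I = "{..<n}"
    have card: "3 \<le> card ?I" using n by simp
    obtain i u where u: "i \<in> ?I" "u i = 1" "4 dvd bil n M u u"
      by (rule unit_vector_norm_dvd_4[OF sym even subset_refl card])
    then have card: "3 \<le> card (?I - {i})" using n by simp
    obtain j v where v: "j \<in> ?I - {i}" "v j = 1" "\<forall>a. a \<notin> ?I - {i} \<longrightarrow> v a = 0" "4 dvd bil n M v v"
      by (rule unit_vector_norm_dvd_4[OF sym even Diff_subset card])
    \<comment> \<open>Here \<open>5 \<le> n\<close> is used in full: two indices are spent and three
      must remain.\<close>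
    then have card: "3 \<le> card (?I - {i, j})" using n u by (simp add: card_Diff_subset)
    obtain k w where w: "k \<in> ?I - {i, j}" "w k = 1" "\<forall>a. a \<notin> ?I - {i, j} \<longrightarrow> w a = 0"
        "4 dvd bil n M w w"
      by (rule unit_vector_norm_dvd_4[OF sym even Diff_subset card])
    have products: "2 dvd bil n M u v" "2 dvd bil n M u w" "2 dvd bil n M v w"
      using radical u v by blast+
    obtain x y z where xyz: "x \<in> {0, 1}" "y \<in> {0, 1}" "x = 1 \<or> y = 1 \<or> z = 1"
      and dvd: "4 * 2 dvd bil n M (\<lambda>i. x * u i + (y * v i + z * w i)) (\<lambda>i. x * u i + (y * v i + z * w i))"
      by (rule bil_combination_dvd[OF sym _ _ _ products]) (use u v w in auto)
    let ?x = "\<lambda>i. x * u i + (y * v i + z * w i)"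
    \<comment> \<open>The coordinates at \<open>i\<close>, \<open>j\<close>, \<open>k\<close> are
      triangular, so the first nonzero one among \<open>x\<close>, \<open>y\<close>,
      \<open>z\<close> is a coordinate of the combination.\<close>
    have "v i = 0" "w i = 0" "w j = 0" using v w by auto
    then have "?x i = x" "x = 0 \<Longrightarrow> ?x j = y" "x = 0 \<Longrightarrow> y = 0 \<Longrightarrow> ?x k = z"
      using u v w by auto
    with xyz have "?x i = 1 \<or> ?x j = 1 \<or> ?x k = 1" by auto
    then show False
      using none dvd u(1) v(1) w(1) by auto
  qed
  with that show thesis by blast
qed

section \<open>Reduction of arbitrary lattices to the normal form\<close>

lemma prim_n_universal_iff: "prim_n_universal n m G \<longleftrightarrow> (\<forall>A. z2_lattice n A \<longrightarrow> prim_rep m G n A)"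
  by (simp add: prim_n_universal_def prim_rep_def)

text \<open>The Gram matrix is its own inverse, so its determinant is odd and nondegeneracy is
  visible at level \<open>1\<close>.\<close>

lemma z2_lattice_H_perp_gram: "z2_lattice (2 * Suc t) (H_perp_gram (Suc t))"
proof -
  let ?G = "\<lambda>i j. H_perp_gram (Suc t) i j 1"
  have "mprod (2 * Suc t) ?G ?G i j = mid i j" if i: "i < 2 * Suc t" and j: "j < 2 * Suc t" for i j
  proof -
    have "mprod (2 * Suc t) ?G ?G i j = (if i < 2 * t then if even i then ?G (Suc i) j else ?G (i - 1) j
        else if i = 2 * t then ?G i j else - ?G i j)"
      unfolding mprod_def by (rule H_perp_gram_apply[OF i])
    also have "\<dots> = mid i j"
      using i
    proof (cases rule: nat_pair_cases)
      case (even b)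
      then show ?thesis using j by (auto simp: H_perp_gram_def z2_const_def mid_def)
    next
      case (odd b)
      then show ?thesis using j by (auto simp: H_perp_gram_def z2_const_def mid_def elim: oddE)
    qed (use j in \<open>auto simp: H_perp_gram_def z2_const_def mid_def\<close>)
    finally show ?thesis .
  qed
  then have "[idet (2 * Suc t) (mprod (2 * Suc t) ?G ?G) = idet (2 * Suc t) mid] (mod 2)"
    by (intro idet_mcong) (simp add: mcong_def)
  then have "[idet (2 * Suc t) ?G * idet (2 * Suc t) ?G = 1] (mod 2)"
    by (simp only: idet_mprod idet_mid)
  from cong_dvd_iff[OF this] have "odd (idet (2 * Suc t) ?G)" by simp
  then have "\<not> [idet (2 * Suc t) ?G = 0] (mod 2 ^ 1)"
    by (simp add: cong_0_iff)
  moreover have "valid_mat (2 * Suc t) (2 * Suc t) (H_perp_gram (Suc t))"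
    by (simp add: valid_mat_def H_perp_gram_def z2_const_def z2_valid_const)
  moreover have "z2_eq (H_perp_gram (Suc t) i j) (H_perp_gram (Suc t) j i)" for i j
    by (auto simp: z2_eq_def H_perp_gram_def z2_const_def)
  ultimately show ?thesis
    unfolding z2_lattice_def by blast
qed

text \<open>The hypothesis gives \<open>N^2 = 0\<close> term by term, so
  \<open>(1 + N) (1 - N) = 1\<close>; the other order is the same identity for
  \<open>-N\<close>.\<close>

lemma inverse_pair_transvection:
  assumes "\<And>a b c. N a b * N b c = 0"
  shows "inverse_pair n (\<lambda>a b. mid a b + N a b) (\<lambda>a b. mid a b - N a b)"
proof -
  have "mprod n (\<lambda>a b. mid a b + N a b) (\<lambda>a b. mid a b - N a b) i j = mid i j"
    if "i < n" "j < n" and N: "\<And>a b c. N a b * N b c = 0" for i j and N :: "nat \<Rightarrow> nat \<Rightarrow> int"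
  proof -
    have "mprod n (\<lambda>a b. mid a b + N a b) (\<lambda>a b. mid a b - N a b) i j =
        mprod n mid (\<lambda>a b. mid a b - N a b) i j + mprod n N mid i j - mprod n N N i j"
      unfolding mprod_def sum.distrib[symmetric] sum_subtractf[symmetric]
      by (intro sum.cong) (simp_all add: algebra_simps)
    moreover have "mprod n N N i j = 0"
      unfolding mprod_def by (intro sum.neutral ballI N)
    ultimately show ?thesis
      using that by (simp add: mprod_mid_left mprod_mid_right)
  qed
  from this[of _ _ N] this[of _ _ "\<lambda>a b. - N a b"] show ?thesis
    unfolding inverse_pair_def using assms by simp
qed

lemma inverse_pair_permutation:
  assumes "p permutes {..<n}" and "\<And>a. p (p a) = a"
  shows "inverse_pair n (\<lambda>a b. mid a (p b)) (\<lambda>a b. mid a (p b))"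
proof -
  have "mprod n (\<lambda>a b. mid a (p b)) (\<lambda>a b. mid a (p b)) i j = mid i j" if "i < n" "j < n" for i j
  proof -
    have "p j < n" using assms(1) that permutes_in_image[of p "{..<n}" j] by simp
    then show ?thesis
      using sum_mid_right[of "p j" n "\<lambda>k. mid i (p k)"] assms(2) by (simp add: mprod_def)
  qed
  then show ?thesis by (simp add: inverse_pair_def)
qed

lemma gram_change_eq_bil:
  "gram_change n T A i j k = bil n (\<lambda>a b. A a b k) (\<lambda>a. T a i) (\<lambda>b. T b j)"
  by (simp add: gram_change_def mprod_def mtr_def bil_def sum_distrib_left mult.assoc)

lemma valid_mat_gram_change: "valid_mat n n A \<Longrightarrow> valid_mat n n (gram_change n T A)"
  unfolding valid_mat_def gram_change_eq_bil[abs_def] bil_def by (auto intro!: z2_valid_intros)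

lemma z2_eq_gram_change:
  assumes "\<And>i j. i < n \<Longrightarrow> j < n \<Longrightarrow> z2_eq (A i j) (A j i)"
  shows "z2_eq (gram_change n T A i j) (gram_change n T A j i)"
  unfolding z2_eq_def
proof
  fix k
  have "gram_change n T A j i k = (\<Sum>b<n. \<Sum>a<n. T a j * A a b k * T b i)"
    unfolding gram_change_eq_bil bil_def by (rule sum.swap)
  moreover have "[gram_change n T A i j k = (\<Sum>b<n. \<Sum>a<n. T b i * A a b k * T a j)] (mod 2 ^ k)"
    unfolding gram_change_eq_bil bil_def
    using assms by (intro cong_sum cong_mult) (auto simp: z2_eq_def)
  ultimately show "[gram_change n T A i j k = gram_change n T A j i k] (mod 2 ^ k)"
    by (simp add: mult.commute mult.left_commute)
qed

text \<open>Exchanging the indices \<open>s\<close> and \<open>t\<close> puts the distinguished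
  vector last, as the normal form expects.\<close>

lemma prim_rep_special_index:
  assumes valid: "valid_mat (Suc t) (Suc t) A"
    and sym: "\<And>i j. i < Suc t \<Longrightarrow> j < Suc t \<Longrightarrow> z2_eq (A i j) (A j i)"
    and s: "s < Suc t"
    and even: "\<And>i. i < Suc t \<Longrightarrow> i \<noteq> s \<Longrightarrow> even (A i i 1)"
    and norm: "odd (A s s 1) \<or> 8 dvd A s s 3"
  shows "prim_rep (2 * Suc t) (H_perp_gram (Suc t)) (Suc t) A"
proof -
  let ?p = "Transposition.transpose s t"
  let ?T = "\<lambda>a b. mid a (?p b)"
  have p: "?p permutes {..<Suc t}"
    using s by (intro permutes_swap_id) auto
  have T: "gram_change (Suc t) ?T A i j k = A (?p i) (?p j) k" if "i < Suc t" "j < Suc t" for i j k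
  proof -
    have "?p i < Suc t" "?p j < Suc t"
      using that permutes_in_image[OF p, of i] permutes_in_image[OF p, of j] by auto
    then have "bil (Suc t) (\<lambda>a b. A a b k) (mid (?p i)) (mid (?p j)) = A (?p i) (?p j) k"
      by (rule bil_mid_mid)
    moreover have "(\<lambda>a. ?T a i) = mid (?p i)" for i
      by (auto simp: mid_def)
    ultimately show ?thesis
      by (simp add: gram_change_eq_bil)
  qed
  have "prim_rep (2 * Suc t) (H_perp_gram (Suc t)) (Suc t) (gram_change (Suc t) ?T A)"
  proof (rule prim_rep_normal_form)
    show "even (gram_change (Suc t) ?T A i i 1)" if "i < t" for i
    proof -
      have "?p i < Suc t" "?p i \<noteq> s"
        using that s by (auto simp: Transposition.transpose_def)
      then show ?thesis
        using that even[of "?p i"] by (simp add: T)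
    qed
    show "odd (gram_change (Suc t) ?T A t t 1) \<or> 8 dvd gram_change (Suc t) ?T A t t 3"
      using norm by (simp add: T)
  qed (use valid sym in \<open>auto intro!: valid_mat_gram_change z2_eq_gram_change\<close>)
  moreover have "inverse_pair (Suc t) ?T ?T"
    using p by (rule inverse_pair_permutation) simp
  ultimately show ?thesis
    by (rule_tac prim_rep_gram_change)
qed

text \<open>The base change adds the basis vector \<open>s\<close> to every other one of odd norm;
  each such norm changes by an odd number and becomes even.\<close>

lemma prim_rep_odd:
  assumes valid: "valid_mat (Suc t) (Suc t) A"
    and sym: "\<And>i j. i < Suc t \<Longrightarrow> j < Suc t \<Longrightarrow> z2_eq (A i j) (A j i)"
    and s: "s < Suc t" and odd: "odd (A s s 1)"
  shows "prim_rep (2 * Suc t) (H_perp_gram (Suc t)) (Suc t) A"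
proof -
  define N where "N a b = (if a = s \<and> b \<noteq> s \<and> odd (A b b 1) then 1 else 0 :: int)" for a b
  let ?T = "\<lambda>a b. mid a b + N a b"
  let ?M = "\<lambda>a b. A a b 1"
  have col: "(\<lambda>a. ?T a j) = (\<lambda>a. mid j a + N s j * mid s a)" for j
    by (auto simp: mid_def N_def)
  have diag: "gram_change (Suc t) ?T A j j 1 =
      ?M j j + N s j * ?M j s + N s j * ?M s j + N s j * N s j * ?M s s" if "j < Suc t" for j
    unfolding gram_change_eq_bil col bil_add_left bil_add_right bil_scale_left bil_scale_right
    using s that by (simp add: bil_mid_mid)
  have "prim_rep (2 * Suc t) (H_perp_gram (Suc t)) (Suc t) (gram_change (Suc t) ?T A)"
  proof (rule prim_rep_special_index[OF _ _ s])
    show "even (gram_change (Suc t) ?T A i i 1)" if i: "i < Suc t" "i \<noteq> s" for i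
    proof -
      \<comment> \<open>Representatives at level \<open>1\<close> are symmetric only modulo
        \<open>2\<close>, which is enough for the two mixed terms to have an even sum.\<close>
      have "[?M i s = ?M s i] (mod 2 ^ 1)"
        using sym[OF i(1) s] unfolding z2_eq_def by blast
      then have "even (?M i s) \<longleftrightarrow> even (?M s i)"
        by (intro cong_dvd_iff) simp
      then show ?thesis
        unfolding diag[OF i(1)] using odd i by (simp add: N_def)
    qed
    have "N s s = 0" by (simp add: N_def)
    then show "odd (gram_change (Suc t) ?T A s s 1) \<or> 8 dvd gram_change (Suc t) ?T A s s 3"
      unfolding diag[OF s] using odd by simp
  qed (use valid sym in \<open>auto intro!: valid_mat_gram_change z2_eq_gram_change\<close>)
  moreover have "inverse_pair (Suc t) ?T (\<lambda>a b. mid a b - N a b)"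
    by (rule inverse_pair_transvection) (simp add: N_def)
  ultimately show ?thesis
    by (rule_tac prim_rep_gram_change)
qed

text \<open>A vector \<open>x\<close> of norm divisible by \<open>8\<close> with a coordinate
  \<open>1\<close> replaces the basis vector at that coordinate and becomes the distinguished one;
  the other norms are even already.\<close>

lemma prim_rep_even:
  assumes valid: "valid_mat (Suc t) (Suc t) A"
    and sym: "\<And>i j. i < Suc t \<Longrightarrow> j < Suc t \<Longrightarrow> z2_eq (A i j) (A j i)"
    and even: "\<And>i. i < Suc t \<Longrightarrow> even (A i i 1)" and t: "5 \<le> Suc t"
  shows "prim_rep (2 * Suc t) (H_perp_gram (Suc t)) (Suc t) A"
proof -
  let ?n = "Suc t"
  \<comment> \<open>The entries at level \<open>3\<close> are symmetric only modulo
    \<open>8\<close>; copying the upper triangle gives an exactly symmetric integer matrix congruent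
    to them.\<close>
  define M where "M a b = (if a \<le> b then A a b 3 else A b a 3)" for a b
  have M: "[A a b 3 = M a b] (mod 2 ^ 3)" if "a < ?n" "b < ?n" for a b
  proof -
    have "[A a b 3 = A b a 3] (mod 2 ^ 3)"
      using sym[OF that] unfolding z2_eq_def by blast
    then show ?thesis by (simp add: M_def)
  qed
  have sym_M: "\<forall>a<?n. \<forall>b<?n. M a b = M b a"
    using le_antisym by (fastforce simp: M_def)
  have "even (M a a)" if a: "a < ?n" for a
  proof -
    have "[A a a 3 = A a a 1] (mod 2 ^ 1)"
      using valid a by (intro z2_valid_le) (auto simp: valid_mat_def)
    then have "even (A a a 3) \<longleftrightarrow> even (A a a 1)"
      by (intro cong_dvd_iff) simp
    with even[OF a] show ?thesis by (simp add: M_def)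
  qed
  then have even_M: "\<forall>a<?n. even (M a a)" by blast
  obtain s x where s: "s < ?n" and xs: "x s = 1" and norm: "8 dvd bil ?n M x x"
    by (rule unit_vector_norm_dvd_8[OF sym_M even_M t])
  \<comment> \<open>Since \<open>x s = 1\<close>, replacing column \<open>s\<close> of the identity
    by \<open>x\<close> only adds entries off the diagonal, which makes it a transvection.\<close>
  define N where "N a b = (if b = s \<and> a \<noteq> s then x a else 0)" for a b
  let ?T = "\<lambda>a b. mid a b + N a b"
  have col_s: "(\<lambda>a. ?T a s) = x"
    using xs by (auto simp: N_def mid_def)
  have col: "(\<lambda>a. ?T a j) = mid j" if "j \<noteq> s" for j
    using that by (auto simp: N_def mid_def)
  have "prim_rep (2 * ?n) (H_perp_gram ?n) ?n (gram_change ?n ?T A)"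
  proof (rule prim_rep_special_index[OF _ _ s])
    show "even (gram_change ?n ?T A i i 1)" if i: "i < ?n" "i \<noteq> s" for i
      unfolding gram_change_eq_bil col[OF i(2)] using i even by (simp add: bil_mid_mid)
    have "[bil ?n (\<lambda>a b. A a b 3) x x = bil ?n M x x] (mod 2 ^ 3)"
      unfolding bil_def using M by (intro cong_sum cong_mult) auto
    then have "8 dvd bil ?n (\<lambda>a b. A a b 3) x x"
      using norm cong_dvd_iff[of "bil ?n (\<lambda>a b. A a b 3) x x" "bil ?n M x x" 8] by simp
    then show "odd (gram_change ?n ?T A s s 1) \<or> 8 dvd gram_change ?n ?T A s s 3"
      unfolding gram_change_eq_bil col_s by blast
  qed (use valid sym in \<open>auto intro!: valid_mat_gram_change z2_eq_gram_change\<close>)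
  moreover have "inverse_pair ?n ?T (\<lambda>a b. mid a b - N a b)"
    by (rule inverse_pair_transvection) (simp add: N_def)
  ultimately show ?thesis
    by (rule_tac prim_rep_gram_change)
qed

lemma prim_n_universal_H_perp_gram:
  assumes "5 \<le> Suc t"
  shows "prim_n_universal (Suc t) (2 * Suc t) (H_perp_gram (Suc t))"
  unfolding prim_n_universal_iff
proof (intro allI impI)
  fix A assume "z2_lattice (Suc t) A"
  then have A: "valid_mat (Suc t) (Suc t) A" "\<And>i j. i < Suc t \<Longrightarrow> j < Suc t \<Longrightarrow> z2_eq (A i j) (A j i)"
    unfolding z2_lattice_def by blast+
  show "prim_rep (2 * Suc t) (H_perp_gram (Suc t)) (Suc t) A"
    using prim_rep_odd[OF A] prim_rep_even[OF A _ assms] by blast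
qed

theorem theorem6p8:
  fixes n :: nat
  assumes "n \<ge> 5"
  shows "z2_lattice (2 * n) (H_perp_gram n) \<and> prim_n_universal n (2 * n) (H_perp_gram n)
         \<and> u_star n = 2 * n"
proof -
  \<comment> \<open>\<open>t = n - 1\<close> is the number of hyperbolic planes.\<close>
  obtain t where t: "n = Suc t"
    using assms by (cases n) auto
  have lattice: "z2_lattice (2 * n) (H_perp_gram n)"
    and universal: "prim_n_universal n (2 * n) (H_perp_gram n)"
    using z2_lattice_H_perp_gram[of t] prim_n_universal_H_perp_gram[of t] assms unfolding t by auto
  moreover have "u_star n = 2 * n"
    unfolding u_star_def
    using lattice universal prim_n_universal_rank_ge by (intro Least_equality) blast+
  ultimately show ?thesis by blast
qed

end
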